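(* Let $\mathfrak n_{4,1}$ be the Lie algebra over $\mathbb F$ with ordered basis $\{x_1,x_2,x_3,x_4\}$ whose only nonzero brackets of basis elements (up to skew-symmetry) are $[x_4,x_2]=-x_1$ and $[x_4,x_3]=-x_2$. Then for all $j,k,l,m,n,p,q,r\in\mathbb Z_{\ge0}$ the following identity holds in $\mathbf U(\mathfrak n_{4,1})$: $$\begin{aligned} &(x_1^jx_2^kx_3^lx_4^m)(x_1^nx_2^px_3^qx_4^r)\\ &=\sum_{\alpha=0}^{\min\{m,p\}}\ \sum_{\substack{\beta_1,\beta_2\in\mathbb Z_{\ge0}\\ \beta_1+\beta_2\leq q\\ \beta_1+2\beta_2\leq m-\alpha}}\binom{m}{\alpha}\binom{p}{\alpha}\binom{q}{\beta_1+\beta_2}\binom{m-\alpha}{\beta_1+2\beta_2}\binom{\beta_1+\beta_2}{\beta_1}\alpha!\,\frac{(\beta_1+2\beta_2)!}{2^{\beta_2}}(-1)^{\alpha+\beta_1}\\ &\quad\times x_1^{j+n+\alpha+\beta_2}x_2^{k+p-\alpha+\beta_1}x_3^{l+q-\beta_1-\beta_2}x_4^{m+r-\alpha-\beta_1-2\beta_2}. \end{aligned}$$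
   Context: $\mathbb F$ is $\mathbb R$ or $\mathbb C$. $\mathbf U(L)$ denotes the universal enveloping algebra of the Lie algebra $L$ (the universal unital associative $\mathbb F$-algebra with a linear map $\iota:L\to\mathbf U(L)$ satisfying $\iota([x,y])=\iota(x)\iota(y)-\iota(y)\iota(x)$). Elements of $L$ are identified with their images under $\iota$, so $xy=yx+[x,y]$ in $\mathbf U(L)$ for $x,y\in L$; powers and products of the $x_i$ are taken in $\mathbf U(L)$. *)

theory Defs
  imports "HOL-Analysis.Analysis" "HOL-Library.Poly_Mapping"
begin

locale lie_algebra = vector_space scl
  for scl :: "'f::field \<Rightarrow> 'v::ab_group_add \<Rightarrow> 'v" +
  fixes bracket :: "'v \<Rightarrow> 'v \<Rightarrow> 'v"
  assumes bracket_add_left: "bracket (x + y) z = bracket x z + bracket y z"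
    and bracket_add_right: "bracket x (y + z) = bracket x y + bracket x z"
    and bracket_scale_left: "bracket (scl c x) y = scl c (bracket x y)"
    and bracket_scale_right: "bracket x (scl c y) = scl c (bracket x y)"
    and bracket_self: "bracket x x = 0"
    and jacobi: "bracket x (bracket y z) + bracket y (bracket z x) + bracket z (bracket x y) = 0"

locale assoc_algebra = vector_space scl
  for scl :: "'f::field \<Rightarrow> 'a::ring_1 \<Rightarrow> 'a" +
  assumes scale_mult_left: "scl c a * b = scl c (a * b)"
    and scale_mult_right: "a * scl c b = scl c (a * b)"

text \<open>
  Words under concatenation, written additively: this makes \<open>'v word\<close> an index type for
  which the convolution product of \<^theory>\<open>HOL-Library.Poly_Mapping\<close> is the product of
  noncommutative polynomials.
\<close>

datatype 'v word = Word (letters: "'v list")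

instantiation word :: (type) monoid_add
begin
definition zero_word :: "'a word" where "0 = Word []"
definition plus_word :: "'a word \<Rightarrow> 'a word \<Rightarrow> 'a word"
  where "u + v = Word (letters u @ letters v)"
instance by standard (simp_all add: zero_word_def plus_word_def)
end

type_synonym ('f, 'v) free_alg = "'v word \<Rightarrow>\<^sub>0 'f"

definition letter :: "'v \<Rightarrow> ('f::field, 'v) free_alg"
  where "letter x = Poly_Mapping.single (Word [x]) 1"

definition const :: "'f::field \<Rightarrow> ('f, 'v) free_alg"
  where "const c = Poly_Mapping.single 0 c"

lemma const_0 [simp]: "const 0 = 0"
  and const_1 [simp]: "const 1 = 1"
  and const_add: "const (c + d) = const c + const d"
  and const_mult: "const (c * d) = const c * const d"
  by (simp_all add: const_def single_add mult_single)

lemma update_conv_add: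
  "w \<notin> Poly_Mapping.keys g \<Longrightarrow> Poly_Mapping.update w c g = Poly_Mapping.single w c + g"
  by (intro poly_mapping_eqI) (auto simp: lookup_update lookup_add lookup_single in_keys_iff)

lemma const_comm: "const c * a = a * const c"
proof (induction a rule: Poly_Mapping.update_induct)
  case const
  then show ?case by simp
next
  case (update g w d)
  have "const c * Poly_Mapping.single w d = Poly_Mapping.single w d * const c"
    by (simp add: const_def mult_single mult.commute)
  then show ?case using update by (simp add: update_conv_add distrib_left distrib_right)
qed

lemma free_alg_induct [case_names zero add mult_const mult_letter]:
  fixes a :: "('f::field, 'v) free_alg"
  assumes "P 0" and add: "\<And>a b. P a \<Longrightarrow> P b \<Longrightarrow> P (a + b)"
    and const: "\<And>c. P (const c)" and letter: "\<And>x a. P a \<Longrightarrow> P (letter x * a)"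
  shows "P a"
proof -
  have single: "P (Poly_Mapping.single (Word xs) c)" for xs c
  proof (induction xs)
    case Nil
    then show ?case using const [of c] by (simp add: const_def zero_word_def)
  next
    case (Cons x xs)
    have "Poly_Mapping.single (Word (x # xs)) c = letter x * Poly_Mapping.single (Word xs) c"
      by (simp add: letter_def mult_single plus_word_def)
    then show ?case using letter [OF Cons] by simp
  qed
  show ?thesis
  proof (induction a rule: Poly_Mapping.update_induct)
    case const
    then show ?case using \<open>P 0\<close> by simp
  next
    case (update f w c)
    have "Poly_Mapping.update w c f = Poly_Mapping.single w c + f"
      using update.hyps(1) by (rule update_conv_add)
    then show ?case using add [OF single update.IH] by (cases w) simp
  qed
qed

text \<open>The algebra homomorphism into an associative algebra extending a map \<open>f\<close> on letters.\<close>

definition free_lift :: "('f::field \<Rightarrow> 'a::ring_1 \<Rightarrow> 'a) \<Rightarrow> ('v \<Rightarrow> 'a) \<Rightarrow> ('f, 'v) free_alg \<Rightarrow> 'a"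
  where "free_lift scl f a =
    (\<Sum>w\<in>Poly_Mapping.keys a. scl (Poly_Mapping.lookup a w) (prod_list (map f (letters w))))"

context assoc_algebra
begin

lemma free_lift_superset:
  assumes "finite S" "Poly_Mapping.keys a \<subseteq> S"
  shows "free_lift scl f a = (\<Sum>w\<in>S. scl (Poly_Mapping.lookup a w) (prod_list (map f (letters w))))"
  unfolding free_lift_def using assms by (intro sum.mono_neutral_left) (auto simp: in_keys_iff)

lemma free_lift_0 [simp]: "free_lift scl f 0 = 0"
  by (simp add: free_lift_def)

lemma free_lift_add: "free_lift scl f (a + b) = free_lift scl f a + free_lift scl f b"
proof -
  have "Poly_Mapping.keys (a + b) \<subseteq> Poly_Mapping.keys a \<union> Poly_Mapping.keys b" by (rule Poly_Mapping.keys_add)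
  then show ?thesis
    by (simp add: free_lift_superset [where S = "Poly_Mapping.keys a \<union> Poly_Mapping.keys b"] lookup_add scale_left_distrib
        sum.distrib)
qed

lemma free_lift_single:
  "free_lift scl f (Poly_Mapping.single w c) = scl c (prod_list (map f (letters w)))"
  by (simp add: free_lift_def)

lemma free_lift_const: "free_lift scl f (const c) = scl c 1"
  by (simp add: const_def free_lift_single zero_word_def)

lemma free_lift_letter: "free_lift scl f (letter x) = f x"
  by (simp add: letter_def free_lift_single)

lemma free_lift_uminus: "free_lift scl f (- a) = - free_lift scl f a"
  using free_lift_add [of f a "- a"] by (simp add: eq_neg_iff_add_eq_0 add.commute)

lemma free_lift_diff: "free_lift scl f (a - b) = free_lift scl f a - free_lift scl f b"
  using free_lift_add [of f a "- b"] by (simp add: free_lift_uminus)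

lemma free_lift_mult: "free_lift scl f (a * b) = free_lift scl f a * free_lift scl f b"
proof -
  have single: "free_lift scl f (Poly_Mapping.single u c * Poly_Mapping.single v d) =
      free_lift scl f (Poly_Mapping.single u c) * free_lift scl f (Poly_Mapping.single v d)"
    for u v c d
    by (simp add: mult_single free_lift_single plus_word_def scale_mult_left scale_mult_right
        mult.commute)
  have left: "free_lift scl f (Poly_Mapping.single u c * b) =
      free_lift scl f (Poly_Mapping.single u c) * free_lift scl f b" for u c
  proof (induction b rule: Poly_Mapping.update_induct)
    case const
    then show ?case by simp
  next
    case (update g w d)
    then show ?case by (simp add: update_conv_add distrib_left free_lift_add single)
  qed
  show ?thesis
  proof (induction a rule: Poly_Mapping.update_induct)
    case const
    then show ?case by simp
  next
    case (update g w d)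
    then show ?case by (simp add: update_conv_add distrib_right free_lift_add left)
  qed
qed

end

text \<open>
  The two-sided ideal of the free algebra on the underlying set of a Lie algebra generated by
  the relations saying that the canonical map is linear and takes the Lie bracket to the
  commutator.  The first two families of relations cut the free algebra down to the tensor
  algebra, so the quotient is the usual one.
\<close>

inductive_set uea_ideal :: "('f::field \<Rightarrow> 'v::ab_group_add \<Rightarrow> 'v) \<Rightarrow> ('v \<Rightarrow> 'v \<Rightarrow> 'v)
    \<Rightarrow> ('f, 'v) free_alg set"
  for scl :: "'f::field \<Rightarrow> 'v::ab_group_add \<Rightarrow> 'v" and bracket :: "'v \<Rightarrow> 'v \<Rightarrow> 'v"
  where
    rel_add: "letter (x + y) - letter x - letter y \<in> uea_ideal scl bracket"
  | rel_scale: "letter (scl c x) - const c * letter x \<in> uea_ideal scl bracket"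
  | rel_bracket: "letter (bracket x y) - (letter x * letter y - letter y * letter x)
      \<in> uea_ideal scl bracket"
  | zero: "0 \<in> uea_ideal scl bracket"
  | add: "a \<in> uea_ideal scl bracket \<Longrightarrow> b \<in> uea_ideal scl bracket
      \<Longrightarrow> a + b \<in> uea_ideal scl bracket"
  | mult_left: "a \<in> uea_ideal scl bracket \<Longrightarrow> r * a \<in> uea_ideal scl bracket"
  | mult_right: "a \<in> uea_ideal scl bracket \<Longrightarrow> a * r \<in> uea_ideal scl bracket"

lemma uea_ideal_uminus: "a \<in> uea_ideal scl bracket \<Longrightarrow> - a \<in> uea_ideal scl bracket"
  using uea_ideal.mult_left [of a scl bracket "- 1"] by simp

lemma uea_ideal_diff:
  "a \<in> uea_ideal scl bracket \<Longrightarrow> b \<in> uea_ideal scl bracket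
    \<Longrightarrow> a - b \<in> uea_ideal scl bracket"
  using uea_ideal.add [OF _ uea_ideal_uminus] by fastforce

lemma (in assoc_algebra) free_lift_uea_ideal:
  assumes f: "Vector_Spaces.linear sclL scl f"
    and br: "\<And>x y. f (bracket x y) = f x * f y - f y * f x"
    and a: "a \<in> uea_ideal sclL bracket"
  shows "free_lift scl f a = 0"
  using a
proof induction
  case (rel_add x y)
  then show ?case
    using Vector_Spaces.linear.axioms(3) [OF f]
    by (simp add: free_lift_diff free_lift_letter module_hom_def module_hom_axioms_def)
next
  case (rel_scale c x)
  then show ?case
    using Vector_Spaces.linear.axioms(3) [OF f]
    by (simp add: free_lift_diff free_lift_letter free_lift_mult free_lift_const scale_mult_left
        module_hom_def module_hom_axioms_def)
qed (simp_all add: free_lift_diff free_lift_letter free_lift_mult free_lift_add br)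

text \<open>
  The underlying space is \<open>'f ^ 4\<close> with ordered basis \<open>axis i 1\<close> for \<open>i = 1, 2, 3, 4\<close>.
  (In the index type \<open>4\<close> the numeral \<open>4\<close> denotes the same element as \<open>0\<close>.)  The formula is
  the bilinear skew-symmetric extension of \<open>[x\<^sub>4, x\<^sub>2] = - x\<^sub>1\<close> and \<open>[x\<^sub>4, x\<^sub>3] = - x\<^sub>2\<close>.
\<close>

definition n41_bracket :: "'f::field ^ 4 \<Rightarrow> 'f ^ 4 \<Rightarrow> 'f ^ 4"
  where "n41_bracket u v =
    (u $ 4 * v $ 2 - u $ 2 * v $ 4) *s (- axis 1 1) +
    (u $ 4 * v $ 3 - u $ 3 * v $ 4) *s (- axis 2 1)"

lemma n41_bracket_basis:
  "n41_bracket (axis 4 1) (axis 2 1) = - axis 1 1"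
  "n41_bracket (axis 4 1) (axis 3 1) = - axis 2 1"
  "n41_bracket (axis 1 1) (axis i 1) = 0"
  "n41_bracket (axis 2 1) (axis 3 1) = 0"
  "n41_bracket u u = 0"
  "n41_bracket u v = - n41_bracket v u"
  by (auto simp: n41_bracket_def axis_def vec_eq_iff)

lemma lie_algebra_n41: "lie_algebra (*s) (n41_bracket :: 'f::field ^ 4 \<Rightarrow> _)"
  by unfold_locales (simp_all add: n41_bracket_def vec_eq_iff axis_def algebra_simps)

definition n41_rel :: "('f::field, 'f ^ 4) free_alg \<Rightarrow> ('f, 'f ^ 4) free_alg \<Rightarrow> bool"
  where "n41_rel a b \<longleftrightarrow> a - b \<in> uea_ideal (*s) n41_bracket"

lemma equivp_n41_rel: "equivp n41_rel"
proof (rule equivpI)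
  show "reflp n41_rel"
    by (auto simp: reflp_def n41_rel_def uea_ideal.zero)
  show "symp n41_rel"
    using uea_ideal_uminus by (fastforce simp: symp_def n41_rel_def)
  show "transp n41_rel"
    using uea_ideal.add by (fastforce simp: transp_def n41_rel_def)
qed

quotient_type (overloaded) 'f U_n41 = "('f::field, 'f ^ 4) free_alg" / n41_rel
  by (rule equivp_n41_rel)

lemma assoc_algebra_field: "assoc_algebra ((*) :: 'f::field \<Rightarrow> 'f \<Rightarrow> 'f)"
  by unfold_locales (simp_all add: algebra_simps)

lemma one_notin_uea_ideal:
  "(1 :: ('f::field, 'f ^ 4) free_alg) \<notin> uea_ideal (*s) n41_bracket"
proof
  interpret F: assoc_algebra "(*) :: 'f \<Rightarrow> 'f \<Rightarrow> 'f" by (rule assoc_algebra_field)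
  assume 1: "(1 :: ('f, 'f ^ 4) free_alg) \<in> uea_ideal (*s) n41_bracket"
  have "Vector_Spaces.linear (*s) (*) (\<lambda>x :: 'f ^ 4. 0 :: 'f)"
    by unfold_locales simp_all
  then have "free_lift (*) (\<lambda>x :: 'f ^ 4. 0 :: 'f) 1 = 0"
    by (rule F.free_lift_uea_ideal [OF _ _ 1]) simp
  then show False
    using F.free_lift_const [of "\<lambda>x :: 'f ^ 4. 0" 1] by simp
qed

instantiation U_n41 :: (field) ring_1
begin

lift_definition zero_U_n41 :: "'a U_n41" is 0 .

lift_definition one_U_n41 :: "'a U_n41" is 1 .

lift_definition plus_U_n41 :: "'a U_n41 \<Rightarrow> 'a U_n41 \<Rightarrow> 'a U_n41" is "(+)"
  unfolding n41_rel_def using uea_ideal.add by (metis add_diff_add)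

lift_definition uminus_U_n41 :: "'a U_n41 \<Rightarrow> 'a U_n41" is uminus
  unfolding n41_rel_def using uea_ideal_uminus by fastforce

lift_definition minus_U_n41 :: "'a U_n41 \<Rightarrow> 'a U_n41 \<Rightarrow> 'a U_n41" is "(-)"
proof -
  fix a a' b b' :: "('a, 'a ^ 4) free_alg"
  assume "n41_rel a a'" "n41_rel b b'"
  then have "(a - a') - (b - b') \<in> uea_ideal (*s) n41_bracket"
    unfolding n41_rel_def by (rule uea_ideal_diff)
  then show "n41_rel (a - b) (a' - b')"
    by (simp add: n41_rel_def algebra_simps)
qed

lift_definition times_U_n41 :: "'a U_n41 \<Rightarrow> 'a U_n41 \<Rightarrow> 'a U_n41" is "(*)"
proof -
  fix a a' b b' :: "('a, 'a ^ 4) free_alg"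
  assume "n41_rel a a'" "n41_rel b b'"
  then have "(a - a') * b + a' * (b - b') \<in> uea_ideal (*s) n41_bracket"
    unfolding n41_rel_def by (intro uea_ideal.add uea_ideal.mult_left uea_ideal.mult_right)
  then show "n41_rel (a * b) (a' * b')"
    by (simp add: n41_rel_def algebra_simps)
qed

instance
proof
  show "(0 :: 'a U_n41) \<noteq> 1"
  proof transfer
    show "\<not> n41_rel (0 :: ('a, 'a ^ 4) free_alg) 1"
    proof
      assume "n41_rel (0 :: ('a, 'a ^ 4) free_alg) 1"
      then have "- (0 - 1 :: ('a, 'a ^ 4) free_alg) \<in> uea_ideal (*s) n41_bracket"
        unfolding n41_rel_def by (rule uea_ideal_uminus)
      then show False by (simp add: one_notin_uea_ideal)
    qed
  qed
qed (transfer; simp add: n41_rel_def uea_ideal.zero algebra_simps)+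

end

lift_definition U_scale :: "'f::field \<Rightarrow> 'f U_n41 \<Rightarrow> 'f U_n41"  (infixr \<open>*\<^sub>U\<close> 75)
  is "\<lambda>c a. const c * a"
  unfolding n41_rel_def using uea_ideal.mult_left by (metis right_diff_distrib)

lift_definition \<iota> :: "'f::field ^ 4 \<Rightarrow> 'f U_n41" is letter .

lemma assoc_algebra_U_n41: "assoc_algebra ((*\<^sub>U) :: 'f::field \<Rightarrow> _)"
proof
  fix c d :: 'f and a b :: "'f U_n41"
  show "a * c *\<^sub>U b = c *\<^sub>U (a * b)"
  proof (transfer, goal_cases)
    case (1 a c b)
    have "a * (const c * b) = const c * (a * b)"
      by (metis const_comm mult.assoc)
    then show ?case by (simp add: n41_rel_def uea_ideal.zero)
  qed
qed (transfer; simp add: n41_rel_def uea_ideal.zero const_add const_mult algebra_simps)+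

lemma linear_\<iota>: "Vector_Spaces.linear (*s) (*\<^sub>U) (\<iota> :: 'f::field ^ 4 \<Rightarrow> _)"
proof -
  interpret U: assoc_algebra "(*\<^sub>U) :: 'f \<Rightarrow> 'f U_n41 \<Rightarrow> 'f U_n41"
    by (rule assoc_algebra_U_n41)
  show ?thesis
  proof
    fix x y :: "'f ^ 4" and c :: 'f
    show "\<iota> (x + y) = \<iota> x + \<iota> y"
      by transfer (simp add: n41_rel_def uea_ideal.rel_add diff_diff_eq [symmetric])
    show "\<iota> (c *s x) = c *\<^sub>U \<iota> x"
      by transfer (simp add: n41_rel_def uea_ideal.rel_scale)
  qed
qed

lemma \<iota>_bracket: "\<iota> (n41_bracket x y) = \<iota> x * \<iota> y - \<iota> y * \<iota> x"
  by transfer (simp add: n41_rel_def uea_ideal.rel_bracket)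

lemma U_n41_induct [case_names add const \<iota>]:
  fixes a :: "'f::field U_n41"
  assumes add: "\<And>a b. P a \<Longrightarrow> P b \<Longrightarrow> P (a + b)"
    and const: "\<And>c. P (c *\<^sub>U 1)" and letter: "\<And>x a. P a \<Longrightarrow> P (\<iota> x * a)"
  shows "P a"
proof -
  have "P (abs_U_n41 r)" for r
  proof (induction r rule: free_alg_induct)
    case zero
    then show ?case using const [of 0] by (simp add: U_scale.abs_eq one_U_n41_def)
  next
    case (add a b)
    then show ?case using assms(1) by (metis plus_U_n41.abs_eq)
  next
    case (mult_const c)
    then show ?case using const [of c] by (simp add: U_scale.abs_eq one_U_n41_def)
  next
    case (mult_letter x a)
    then show ?case using letter by (metis times_U_n41.abs_eq \<iota>.abs_eq)
  qed
  then show ?thesis by (metis Quotient3_U_n41 Quotient3_abs_rep)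
qed

text \<open>
  The pair of \<open>U_n41\<close> and \<open>\<iota>\<close> is determined by this property up to unique isomorphism, so the
  quotient above is the universal enveloping algebra.
\<close>

theorem U_n41_universal:
  fixes scl :: "'f::field \<Rightarrow> 'a::ring_1 \<Rightarrow> 'a"
  assumes A: "assoc_algebra scl"
    and f: "Vector_Spaces.linear (*s) scl f"
    and br: "\<And>x y. f (n41_bracket x y) = f x * f y - f y * f x"
  shows "\<exists>!h. Vector_Spaces.linear (*\<^sub>U) scl h \<and> h 1 = 1 \<and>
    (\<forall>a b. h (a * b) = h a * h b) \<and> (\<forall>x. h (\<iota> x) = f x)"
proof -
  interpret A: assoc_algebra scl by (rule A)
  interpret U: assoc_algebra "(*\<^sub>U) :: 'f \<Rightarrow> 'f U_n41 \<Rightarrow> 'f U_n41"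
    by (rule assoc_algebra_U_n41)
  define h where "h a = free_lift scl f (rep_U_n41 a)" for a
  have h_abs: "h (abs_U_n41 r) = free_lift scl f r" for r
  proof -
    have "n41_rel (rep_U_n41 (abs_U_n41 r)) r"
      by (rule rep_abs_rsp_left [OF Quotient3_U_n41])
        (simp add: n41_rel_def uea_ideal.zero)
    then have "free_lift scl f (rep_U_n41 (abs_U_n41 r) - r) = 0"
      unfolding n41_rel_def by (rule A.free_lift_uea_ideal [OF f br])
    then show ?thesis by (simp add: h_def A.free_lift_diff)
  qed
  have ex_abs: "\<exists>r. a = abs_U_n41 r" for a :: "'f U_n41"
    by (metis Quotient3_U_n41 Quotient3_abs_rep)
  have h_add: "h (a + b) = h a + h b" for a b
    using ex_abs [of a] ex_abs [of b] by (auto simp: plus_U_n41.abs_eq h_abs A.free_lift_add)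
  have h_mult: "h (a * b) = h a * h b" for a b
    using ex_abs [of a] ex_abs [of b] by (auto simp: times_U_n41.abs_eq h_abs A.free_lift_mult)
  have h_scale: "h (c *\<^sub>U a) = scl c (h a)" for a c
    using ex_abs [of a]
    by (auto simp: U_scale.abs_eq h_abs A.free_lift_mult A.free_lift_const A.scale_mult_left)
  have h_1: "h 1 = 1"
    using A.free_lift_const [of f 1] by (simp add: one_U_n41_def h_abs)
  have h_\<iota>: "h (\<iota> x) = f x" for x
    by (simp add: \<iota>.abs_eq h_abs A.free_lift_letter)
  show ?thesis
  proof (rule ex1I [of _ h])
    have "Vector_Spaces.linear (*\<^sub>U) scl h"
      by unfold_locales (simp_all add: h_add h_scale)
    then show "Vector_Spaces.linear (*\<^sub>U) scl h \<and> h 1 = 1 \<and>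
        (\<forall>a b. h (a * b) = h a * h b) \<and> (\<forall>x. h (\<iota> x) = f x)"
      by (simp add: h_mult h_1 h_\<iota>)
  next
    fix g assume g: "Vector_Spaces.linear (*\<^sub>U) scl g \<and> g 1 = 1 \<and>
        (\<forall>a b. g (a * b) = g a * g b) \<and> (\<forall>x. g (\<iota> x) = f x)"
    then interpret g: Vector_Spaces.linear "(*\<^sub>U)" scl g by blast
    show "g = h"
    proof
      fix a
      show "g a = h a"
        by (induction a rule: U_n41_induct) (use g in \<open>simp_all add: g.add g.scale h_add h_scale h_mult h_1 h_\<iota>\<close>)
    qed
  qed
qed

abbreviation X :: "4 \<Rightarrow> 'f::field U_n41"
  where "X i \<equiv> \<iota> (axis i 1)"

end

theory Submission
  imports Defs "HOL-Computational_Algebra.Formal_Power_Series"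
begin

text \<open>
  The generators \<open>x\<^sub>1, x\<^sub>2, x\<^sub>3\<close> commute and \<open>x\<^sub>1\<close> is central, so everything rests on moving
  \<open>x\<^sub>4 ^ m\<close> to the right across \<open>x\<^sub>2 ^ p * x\<^sub>3 ^ q\<close>.  All \<open>m\<close> are treated at once by
  the exponential series \<open>E = (\<Sum>m. t ^ m x\<^sub>4 ^ m / m!)\<close>, a formal power series in a central
  variable \<open>t\<close> with coefficients in the algebra.  Conjugation by \<open>E\<close> is \<open>exp (t ad x\<^sub>4)\<close>, and
  \<open>ad x\<^sub>4\<close> takes \<open>x\<^sub>3\<close> to \<open>- x\<^sub>2\<close>, \<open>x\<^sub>2\<close> to \<open>- x\<^sub>1\<close> and \<open>x\<^sub>1\<close> to \<open>0\<close>, so the exponential stops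
  at the quadratic term:
  \<open>E x\<^sub>2 = (x\<^sub>2 - t x\<^sub>1) E\<close> and \<open>E x\<^sub>3 = (x\<^sub>3 - t x\<^sub>2 + (t\<^sup>2 / 2) x\<^sub>1) E\<close>
  (\<open>exp_x4_x2\<close> and \<open>exp_x4_x3\<close>).  Iterating,
  \<open>E x\<^sub>2 ^ p x\<^sub>3 ^ q = (x\<^sub>2 - t x\<^sub>1) ^ p (x\<^sub>3 - t x\<^sub>2 + (t\<^sup>2 / 2) x\<^sub>1) ^ q E\<close>.

  Both powers are of sums of commuting terms, so they are expanded by the
  binomial and the trinomial theorem: \<open>\<alpha>\<close> counts the factors \<open>- t x\<^sub>1\<close> taken from the first
  power, \<open>\<beta>\<^sub>1\<close> and \<open>\<beta>\<^sub>2\<close> count the factors \<open>- t x\<^sub>2\<close> and \<open>(t\<^sup>2 / 2) x\<^sub>1\<close> taken from the second.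
  Comparing coefficients of \<open>t ^ m\<close> gives \<open>x4_power_times\<close>, in which the quotient
  \<open>m! / (m - \<alpha> - \<beta>\<^sub>1 - 2 \<beta>\<^sub>2)!\<close> accounts for the remaining binomial coefficients and factorials
  of the formula.  The argument uses only the commutation relations, so it is carried out in an
  arbitrary associative algebra over a field of characteristic \<open>0\<close>.
\<close>

section \<open>The binomial theorem for commuting elements\<close>

lemma binomial_commuting:
  fixes x y :: "'a::ring_1"
  assumes "x * y = y * x"
  shows "(x + y) ^ n = (\<Sum>k\<le>n. of_nat (n choose k) * (x ^ k * y ^ (n - k)))"
proof (induction n)
  case 0
  show ?case by simp
next
  case (Suc n)
  let ?f = "\<lambda>k. of_nat (n choose k) * (x ^ Suc k * y ^ (n - k))"
  let ?g = "\<lambda>k. of_nat (n choose k) * (x ^ k * y ^ (Suc n - k))"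
  have comm: "y * x ^ k = x ^ k * y" for k
    using power_commuting_commutes[OF assms] by simp
  have x: "x * (of_nat (n choose k) * (x ^ k * y ^ (n - k))) = ?f k" for k
    unfolding power_Suc by (metis mult.assoc mult_of_nat_commute)
  have y: "y * (of_nat (n choose k) * (x ^ k * y ^ (n - k))) = ?g k" if "k \<le> n" for k
  proof -
    have "y * (of_nat (n choose k) * (x ^ k * y ^ (n - k))) =
        of_nat (n choose k) * ((y * x ^ k) * y ^ (n - k))"
      by (metis mult.assoc mult_of_nat_commute)
    then show ?thesis
      using that by (simp add: comm mult.assoc Suc_diff_le)
  qed
  have "(x + y) ^ Suc n = (\<Sum>k\<le>n. ?f k) + (\<Sum>k\<le>n. ?g k)"
    unfolding power_Suc[of "x + y"] Suc.IH distrib_right sum_distrib_left sum.distrib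
    by (intro arg_cong2[of _ _ _ _ plus] sum.cong refl) (simp_all only: x y atMost_iff)
  also have "(\<Sum>k\<le>n. ?g k) = (\<Sum>k\<le>Suc n. ?g k)"
    by (simp add: binomial_eq_0)
  also have "\<dots> = ?g 0 + (\<Sum>k\<le>n. of_nat (n choose Suc k) * (x ^ Suc k * y ^ (n - k)))"
    unfolding sum.atMost_Suc_shift[of ?g] by simp
  also have "(\<Sum>k\<le>n. ?f k) + \<dots> = y ^ Suc n +
      (\<Sum>k\<le>n. of_nat (Suc n choose Suc k) * (x ^ Suc k * y ^ (Suc n - Suc k)))"
    by (simp add: sum.distrib distrib_right add_ac)
  also have "\<dots> = (\<Sum>k\<le>Suc n. of_nat (Suc n choose k) * (x ^ k * y ^ (Suc n - k)))"
    unfolding sum.atMost_Suc_shift[of _ n] by simp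
  finally show ?case .
qed

section \<open>The exponential series of the last generator\<close>

locale n41_algebra = assoc_algebra scl
  for scl :: "'f::field_char_0 \<Rightarrow> 'a::ring_1 \<Rightarrow> 'a" +
  fixes x1 x2 x3 x4 :: 'a
  assumes x2_x1: "x2 * x1 = x1 * x2" and x3_x1: "x3 * x1 = x1 * x3" and x4_x1: "x4 * x1 = x1 * x4"
    and x3_x2: "x3 * x2 = x2 * x3"
    and x4_x2: "x4 * x2 = x2 * x4 - x1"
    and x4_x3: "x4 * x3 = x3 * x4 - x2"
begin

abbreviation monomial :: "'a \<Rightarrow> nat \<Rightarrow> 'a fps" where
  "monomial u s \<equiv> fps_const u * fps_X ^ s"

definition exp_x4 :: "'a fps" where
  "exp_x4 = Abs_fps (\<lambda>m. scl (1 / fact m) (x4 ^ m))"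

lemma scale_of_nat: "scl (of_nat n) x = of_nat n * x"
  by (induction n) (simp_all add: scale_left_distrib distrib_right)

text \<open>
  The relations with a further factor on the right, in the form in which they rewrite products
  associated to the right.
\<close>

lemma x4_x2_assoc: "x4 * (x2 * y) = x2 * (x4 * y) - x1 * y"
  using arg_cong[OF x4_x2, of "\<lambda>z. z * y"] by (simp add: algebra_simps)

lemma x4_x3_assoc: "x4 * (x3 * y) = x3 * (x4 * y) - x2 * y"
  using arg_cong[OF x4_x3, of "\<lambda>z. z * y"] by (simp add: algebra_simps)

lemma x4_x1_assoc: "x4 * (x1 * y) = x1 * (x4 * y)"
  by (metis mult.assoc x4_x1)

text \<open>
  The Leibniz rule \<open>x4 ^ m * y = (\<Sum>s. (m choose s) (ad x4) ^ s (y) * x4 ^ (m - s))\<close> for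
  \<open>y = x2\<close> and \<open>y = x3\<close>, where it has two and three terms.  Successors in place of \<open>m\<close>
  keep the exponents \<open>m - s\<close> free of truncated subtraction.
\<close>

lemma x4_power_x2:
  "x4 ^ Suc m * x2 = x2 * x4 ^ Suc m - scl (of_nat (Suc m)) (x1 * x4 ^ m)"
proof (induction m)
  case 0
  show ?case by (simp add: x4_x2)
next
  case (Suc m)
  have "x4 ^ Suc (Suc m) * x2 = x4 * (x4 ^ Suc m * x2)"
    by (simp add: mult.assoc)
  also have "\<dots> = x2 * x4 ^ Suc (Suc m) - x1 * x4 ^ Suc m - scl (of_nat (Suc m)) (x1 * x4 ^ Suc m)"
    unfolding Suc.IH by (simp add: right_diff_distrib scale_mult_right x4_x2_assoc x4_x1_assoc)
  also have "\<dots> = x2 * x4 ^ Suc (Suc m) - scl (of_nat (Suc m) + 1) (x1 * x4 ^ Suc m)"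
    by (simp only: scale_left_distrib scale_one) (simp add: algebra_simps)
  finally show ?case by (simp add: add_ac)
qed

lemma x4_power_x3:
  "x4 ^ Suc (Suc m) * x3 = x3 * x4 ^ Suc (Suc m) - scl (of_nat (Suc (Suc m))) (x2 * x4 ^ Suc m)
     + scl (of_nat (Suc (Suc m)) * of_nat (Suc m) / 2) (x1 * x4 ^ m)"
proof (induction m)
  case 0
  have two: "scl 2 y = y + y" for y
    using scale_left_distrib[of 1 1 y] by simp
  show ?case by (simp add: x4_x2 x4_x3 x4_x3_assoc right_diff_distrib mult.assoc two algebra_simps)
next
  case (Suc m)
  have coeff: "of_nat (Suc (Suc (Suc m))) * of_nat (Suc (Suc m)) / 2 =
     of_nat (Suc (Suc m)) * of_nat (Suc m) / 2 + (of_nat (Suc (Suc m)) :: 'f)"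
    by (simp add: field_simps)
  have "x4 ^ Suc (Suc (Suc m)) * x3 = x4 * (x4 ^ Suc (Suc m) * x3)"
    by (simp add: mult.assoc)
  also have "\<dots> = x3 * x4 ^ Suc (Suc (Suc m)) - x2 * x4 ^ Suc (Suc m)
     - scl (of_nat (Suc (Suc m))) (x2 * x4 ^ Suc (Suc m))
     + scl (of_nat (Suc (Suc m))) (x1 * x4 ^ Suc m)
     + scl (of_nat (Suc (Suc m)) * of_nat (Suc m) / 2) (x1 * x4 ^ Suc m)"
    unfolding Suc.IH
    by (simp only: power_Suc distrib_left right_diff_distrib
        scale_right_diff_distrib scale_mult_right x4_x3_assoc x4_x2_assoc x4_x1_assoc)
      (simp add: algebra_simps)
  also have "\<dots> = x3 * x4 ^ Suc (Suc (Suc m))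
     - scl (of_nat (Suc (Suc m)) + 1) (x2 * x4 ^ Suc (Suc m))
     + scl (of_nat (Suc (Suc m)) * of_nat (Suc m) / 2 + of_nat (Suc (Suc m))) (x1 * x4 ^ Suc m)"
    by (simp only: scale_left_distrib scale_one) (simp add: algebra_simps)
  finally show ?case unfolding coeff by (simp add: add_ac)
qed

text \<open>
  Division by \<open>m!\<close> absorbs the binomial coefficients of the Leibniz rule, which leaves a
  polynomial in the variable \<open>t\<close> of the series as multiplier: what
  \<open>exp (t ad x4)\<close> makes of \<open>x2\<close>, respectively \<open>x3\<close>.
\<close>

lemma exp_x4_x2:
  "exp_x4 * fps_const x2 = (monomial (- x1) 1 + fps_const x2) * exp_x4"
  (is "_ = ?rhs")
proof (rule fps_ext)
  fix m
  show "fps_nth (exp_x4 * fps_const x2) m = fps_nth ?rhs m"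
  proof (cases m)
    case 0
    then show ?thesis by (simp add: exp_x4_def)
  next
    case (Suc n)
    have "fps_nth (exp_x4 * fps_const x2) (Suc n) = scl (1 / fact (Suc n)) (x4 ^ Suc n * x2)"
      by (simp only: exp_x4_def fps_mult_right_const_nth fps_nth_Abs_fps scale_mult_left)
    also have "\<dots> = scl (1 / fact (Suc n)) (x2 * x4 ^ Suc n) - scl (1 / fact n) (x1 * x4 ^ n)"
      unfolding x4_power_x2 scale_right_diff_distrib scale_scale
      by (simp add: fact_Suc del: of_nat_Suc)
    also have "\<dots> = fps_nth ?rhs (Suc n)"
      by (simp add: exp_x4_def distrib_right mult.assoc scale_mult_right del: power_Suc fact_Suc)
    finally show ?thesis using Suc by simp
  qed
qed

lemma exp_x4_x3:
  "exp_x4 * fps_const x3 =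
    ((monomial (- x2) 1 + monomial (scl (1/2) x1) 2) + fps_const x3) * exp_x4"
  (is "_ = ?rhs")
proof (rule fps_ext)
  fix m
  consider "m = 0" | "m = 1" | n where "m = Suc (Suc n)" by (metis One_nat_def not0_implies_Suc)
  then show "fps_nth (exp_x4 * fps_const x3) m = fps_nth ?rhs m"
  proof cases
    case 1
    then show ?thesis by (simp add: exp_x4_def power2_eq_square)
  next
    case 2
    then show ?thesis
      by (simp add: exp_x4_def distrib_right mult.assoc fps_X_power_mult_nth x4_x3)
  next
    case (3 n)
    have "fps_nth (exp_x4 * fps_const x3) (Suc (Suc n))
      = scl (1 / fact (Suc (Suc n))) (x4 ^ Suc (Suc n) * x3)"
      by (simp only: exp_x4_def fps_mult_right_const_nth fps_nth_Abs_fps scale_mult_left)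
    also have "\<dots> = scl (1 / fact (Suc (Suc n))) (x3 * x4 ^ Suc (Suc n))
      - scl (1 / fact (Suc n)) (x2 * x4 ^ Suc n)
      + scl (1 / fact n) (scl (1/2) (x1 * x4 ^ n))"
      unfolding x4_power_x3 scale_right_diff_distrib scale_right_distrib scale_scale
      by (simp add: fact_Suc del: of_nat_Suc)
    also have "\<dots> = fps_nth ?rhs (Suc (Suc n))"
      by (simp add: exp_x4_def distrib_right mult.assoc scale_mult_right scale_mult_left
          fps_X_power_mult_nth mult.commute del: power_Suc fact_Suc)
    finally show ?thesis using 3 by simp
  qed
qed

section \<open>Expansion of the conjugated powers\<close>

text \<open>The variable of a power series is central even when the coefficients do not commute.\<close>

lemma monomial_mult: "monomial u s * monomial v r = monomial (u * v) (s + r)"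
proof -
  have "monomial u s * monomial v r
      = fps_const u * (fps_X ^ s * fps_const v) * fps_X ^ r"
    by (simp only: mult.assoc)
  also have "fps_X ^ s * fps_const v = fps_const v * fps_X ^ s"
    by (rule fps_mult_fps_X_power_commute)
  also have "fps_const u * (fps_const v * fps_X ^ s) * fps_X ^ r
      = (fps_const u * fps_const v) * (fps_X ^ s * fps_X ^ r)"
    by (simp only: mult.assoc)
  finally show ?thesis by (simp add: power_add)
qed

lemma monomial_power: "monomial u s ^ n = monomial (u ^ n) (s * n)"
  by (induction n) (simp_all add: monomial_mult)

lemma of_nat_monomial: "of_nat c * monomial u s = monomial (scl (of_nat c) u) s"
  by (simp add: scale_of_nat fps_of_nat mult.assoc flip: fps_const_mult)

lemma power_intertwine:
  fixes e :: "'b::monoid_mult"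
  assumes "e * u = v * e"
  shows "e * u ^ n = v ^ n * e"
proof (induction n)
  case (Suc n)
  have "e * u ^ Suc n = v * (e * u ^ n)"
    by (metis assms mult.assoc power_Suc)
  then show ?case by (simp add: Suc.IH mult.assoc)
qed simp

lemma power_uminus_scale: "(- y) ^ n = scl ((- 1) ^ n) (y ^ n)"
  by (induction n) (simp_all add: scale_mult_left scale_mult_right)

lemma power_scale: "scl c y ^ n = scl (c ^ n) (y ^ n)"
  by (induction n) (simp_all add: scale_mult_left scale_mult_right mult.commute)

lemma linear_power_expansion:
  "(monomial (- x1) 1 + fps_const x2) ^ p =
     (\<Sum>\<alpha>\<le>p. monomial (scl (of_nat (p choose \<alpha>) * (- 1) ^ \<alpha>) (x1 ^ \<alpha> * x2 ^ (p - \<alpha>))) \<alpha>)"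
proof -
  have "monomial (- x1) 1 * monomial x2 0 = monomial x2 0 * monomial (- x1) 1"
    unfolding monomial_mult by (simp add: x2_x1)
  from binomial_commuting[OF this, of p] show ?thesis
    unfolding monomial_power monomial_mult of_nat_monomial
    by (simp add: power_uminus_scale scale_mult_left)
qed

text \<open>
  The trinomial theorem, as the binomial theorem applied twice: \<open>\<beta>1 + \<beta>2\<close> factors contribute a
  term other than \<open>x3\<close>, and \<open>\<beta>1\<close> of them contribute the linear one.
\<close>

lemma quadratic_power_expansion:
  "((monomial (- x2) 1 + monomial (scl (1/2) x1) 2) + fps_const x3) ^ q =
     (\<Sum>(\<beta>1, \<beta>2) \<in> {(\<beta>1, \<beta>2). \<beta>1 + \<beta>2 \<le> q}.
       monomial (scl (of_nat (q choose (\<beta>1 + \<beta>2)) * of_nat ((\<beta>1 + \<beta>2) choose \<beta>1) * (- 1) ^ \<beta>1 / 2 ^ \<beta>2)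
         (x2 ^ \<beta>1 * x1 ^ \<beta>2 * x3 ^ (q - (\<beta>1 + \<beta>2)))) (\<beta>1 + 2 * \<beta>2))"
proof -
  let ?Y = "monomial (- x2) 1 + monomial (scl (1/2) x1) 2"
  have comm: "monomial (- x2) 1 * monomial (scl (1/2) x1) 2 = monomial (scl (1/2) x1) 2 * monomial (- x2) 1"
    unfolding monomial_mult by (simp add: x2_x1 scale_mult_left scale_mult_right add.commute)
  have "?Y * monomial x3 0 = monomial x3 0 * ?Y"
    unfolding distrib_left distrib_right monomial_mult
    by (simp add: x3_x1 x3_x2 scale_mult_left scale_mult_right power2_eq_square)
  from binomial_commuting[OF this, of q]
  have "(?Y + fps_const x3) ^ q = (\<Sum>u\<le>q. \<Sum>v\<le>u. of_nat (q choose u) *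
    (of_nat (u choose v) * (monomial (- x2) 1 ^ v * monomial (scl (1/2) x1) 2 ^ (u - v))
      * monomial x3 0 ^ (q - u)))"
    unfolding binomial_commuting[OF comm] by (simp add: sum_distrib_left sum_distrib_right mult.assoc)
  \<comment> \<open>Writing \<open>u\<close> as \<open>v + (u - v)\<close> brings the sum into the form of the triangle reindexing.\<close>
  also have "\<dots> = (\<Sum>u\<le>q. \<Sum>v\<le>u. of_nat (q choose (v + (u - v))) *
    (of_nat ((v + (u - v)) choose v) * (monomial (- x2) 1 ^ v * monomial (scl (1/2) x1) 2 ^ (u - v))
      * monomial x3 0 ^ (q - (v + (u - v)))))"
    by simp
  also have "\<dots> = (\<Sum>(\<beta>1, \<beta>2) \<in> {(\<beta>1, \<beta>2). \<beta>1 + \<beta>2 \<le> q}. of_nat (q choose (\<beta>1 + \<beta>2)) *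
    (of_nat ((\<beta>1 + \<beta>2) choose \<beta>1) * (monomial (- x2) 1 ^ \<beta>1 * monomial (scl (1/2) x1) 2 ^ \<beta>2)
      * monomial x3 0 ^ (q - (\<beta>1 + \<beta>2))))"
    by (rule sum.triangle_reindex_eq[symmetric])
  finally show ?thesis
    unfolding monomial_power monomial_mult of_nat_monomial
    by (simp add: power_uminus_scale power_scale scale_mult_left scale_mult_right power_divide mult_ac)
qed

lemma power_comm: "y * x = x * y \<Longrightarrow> y ^ s * x ^ t = x ^ t * y ^ s" for x y :: 'a
  by (metis power_commuting_commutes)

lemmas x2_x1_power = power_comm[OF x2_x1] and x3_x1_power = power_comm[OF x3_x1]
   and x4_x1_power = power_comm[OF x4_x1] and x3_x2_power = power_comm[OF x3_x2]

lemma power_comm_assoc: "y * x = x * y \<Longrightarrow> y ^ s * (x ^ t * z) = x ^ t * (y ^ s * z)" for x y z :: 'a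
  by (metis power_comm mult.assoc)

text \<open>
  Used as rewrite rules, these facts move powers of generators with a smaller index to the left
  across those with a larger one, where they commute.
\<close>

lemmas normal_order = x2_x1_power x3_x1_power x4_x1_power x3_x2_power
  power_comm_assoc[OF x2_x1] power_comm_assoc[OF x3_x1] power_comm_assoc[OF x4_x1] power_comm_assoc[OF x3_x2]

lemma monomial_exp_x4_nth:
  "fps_nth (monomial u s * exp_x4) m = (if s \<le> m then scl (1 / fact (m - s)) (u * x4 ^ (m - s)) else 0)"
  by (simp add: exp_x4_def mult.assoc fps_X_power_mult_nth scale_mult_right)

text \<open>
  The coefficient of \<open>t ^ m\<close> in \<open>E x2 ^ p x3 ^ q = (\<dots>) ^ p (\<dots>) ^ q E\<close>, multiplied by \<open>m!\<close>.  A
  term of the expansion carries \<open>t\<close> to the power \<open>s = \<alpha> + \<beta>1 + 2 \<beta>2\<close>, so \<open>E\<close> has to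
  supply \<open>t ^ (m - s)\<close>; this is where \<open>s \<le> m\<close> and the quotient of factorials come from.
\<close>

lemma x4_power_times:
  "x4 ^ m * (x2 ^ p * x3 ^ q) =
    (\<Sum>\<alpha>\<le>p. \<Sum>(\<beta>1, \<beta>2) \<in> {(\<beta>1, \<beta>2). \<beta>1 + \<beta>2 \<le> q}.
       if \<alpha> + (\<beta>1 + 2 * \<beta>2) \<le> m then
       scl (of_nat (p choose \<alpha>) * (- 1) ^ \<alpha> *
         (of_nat (q choose (\<beta>1 + \<beta>2)) * of_nat ((\<beta>1 + \<beta>2) choose \<beta>1) * (- 1) ^ \<beta>1 / 2 ^ \<beta>2)
         * (fact m / fact (m - (\<alpha> + (\<beta>1 + 2 * \<beta>2)))))
        (x1 ^ (\<alpha> + \<beta>2) * x2 ^ (p - \<alpha> + \<beta>1) * x3 ^ (q - (\<beta>1 + \<beta>2)) * x4 ^ (m - (\<alpha> + (\<beta>1 + 2 * \<beta>2)))) else 0)"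
proof -
  have "exp_x4 * fps_const (x2 ^ p * x3 ^ q) = (exp_x4 * fps_const x2 ^ p) * fps_const x3 ^ q"
    by (simp add: fps_const_power mult.assoc)
  also have "\<dots> = (monomial (- x1) 1 + fps_const x2) ^ p * (exp_x4 * fps_const x3 ^ q)"
    using power_intertwine[OF exp_x4_x2, of p] by (simp add: mult.assoc)
  also have "\<dots> = (monomial (- x1) 1 + fps_const x2) ^ p *
      (((monomial (- x2) 1 + monomial (scl (1/2) x1) 2) + fps_const x3) ^ q * exp_x4)"
    using power_intertwine[OF exp_x4_x3, of q] by simp
  also have "\<dots> = (\<Sum>\<alpha>\<le>p. \<Sum>(\<beta>1, \<beta>2) \<in> {(\<beta>1, \<beta>2). \<beta>1 + \<beta>2 \<le> q}.
      monomial (scl (of_nat (p choose \<alpha>) * (- 1) ^ \<alpha>) (x1 ^ \<alpha> * x2 ^ (p - \<alpha>))) \<alpha> *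
      monomial (scl (of_nat (q choose (\<beta>1 + \<beta>2)) * of_nat ((\<beta>1 + \<beta>2) choose \<beta>1) * (- 1) ^ \<beta>1 / 2 ^ \<beta>2)
         (x2 ^ \<beta>1 * x1 ^ \<beta>2 * x3 ^ (q - (\<beta>1 + \<beta>2)))) (\<beta>1 + 2 * \<beta>2) * exp_x4)"
    unfolding linear_power_expansion quadratic_power_expansion sum_distrib_right
    unfolding sum_distrib_left case_prod_unfold mult.assoc ..
  also have "\<dots> = (\<Sum>\<alpha>\<le>p. \<Sum>(\<beta>1, \<beta>2) \<in> {(\<beta>1, \<beta>2). \<beta>1 + \<beta>2 \<le> q}.
      monomial (scl (of_nat (p choose \<alpha>) * (- 1) ^ \<alpha> *
         (of_nat (q choose (\<beta>1 + \<beta>2)) * of_nat ((\<beta>1 + \<beta>2) choose \<beta>1) * (- 1) ^ \<beta>1 / 2 ^ \<beta>2))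
         (x1 ^ (\<alpha> + \<beta>2) * x2 ^ (p - \<alpha> + \<beta>1) * x3 ^ (q - (\<beta>1 + \<beta>2)))) (\<alpha> + (\<beta>1 + 2 * \<beta>2)) * exp_x4)"
    (is "_ = ?expansion")
    unfolding monomial_mult scale_mult_left unfolding scale_mult_right scale_scale
    by (simp only: mult.assoc normal_order power_add)
  finally have "exp_x4 * fps_const (x2 ^ p * x3 ^ q) = ?expansion" .
  then have "scl (fact m) (fps_nth (exp_x4 * fps_const (x2 ^ p * x3 ^ q)) m) = scl (fact m) (fps_nth ?expansion m)"
    by (rule arg_cong)
  moreover have "scl (fact m) (fps_nth (exp_x4 * fps_const (x2 ^ p * x3 ^ q)) m) = x4 ^ m * (x2 ^ p * x3 ^ q)"
    by (simp add: exp_x4_def scale_mult_left)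
  ultimately have "x4 ^ m * (x2 ^ p * x3 ^ q) = scl (fact m) (fps_nth ?expansion m)"
    by simp
  then show ?thesis
    unfolding fps_sum_nth case_prod_unfold monomial_exp_x4_nth scale_sum_right
    by (simp add: scale_mult_left if_distrib mult_ac cong: if_cong)
qed

section \<open>Products of ordered monomials\<close>

lemma finite_pairs: "finite {(a, b). a + b \<le> (q::nat)}"
  by (rule finite_subset[of _ "{..q} \<times> {..q}"]) auto

text \<open>
  Choosing \<open>\<alpha> + s\<close> of the \<open>m\<close> factors \<open>x4\<close> in order amounts to choosing the \<open>\<alpha>\<close> that act on
  \<open>x2\<close> and then, among the rest, the \<open>s\<close> that act on \<open>x3\<close>.
\<close>

lemma falling_factorial_split:
  assumes "\<alpha> \<le> m" "s \<le> m - \<alpha>"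
  shows "fact m / fact (m - (\<alpha> + s)) =
    (of_nat (m choose \<alpha>) * fact \<alpha> * (of_nat ((m - \<alpha>) choose s) * fact s) :: 'f)"
  using assms by (simp add: binomial_fact)

text \<open>
  Only the inner product \<open>x4 ^ m * (x2 ^ p * x3 ^ q)\<close> needs reordering: \<open>x1 ^ n\<close> is central and
  \<open>x4 ^ r\<close> is already on the right.
\<close>

theorem ordered_monomial_product:
  "(x1 ^ j * x2 ^ k * x3 ^ l * x4 ^ m) * (x1 ^ n * x2 ^ p * x3 ^ q * x4 ^ r) =
    (\<Sum>\<alpha> = 0..min m p. \<Sum>(\<beta>1, \<beta>2) \<in> {(\<beta>1, \<beta>2). \<beta>1 + \<beta>2 \<le> q \<and> \<beta>1 + 2 * \<beta>2 \<le> m - \<alpha>}.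
        scl (of_nat (m choose \<alpha>) * of_nat (p choose \<alpha>) * of_nat (q choose (\<beta>1 + \<beta>2))
          * of_nat ((m - \<alpha>) choose (\<beta>1 + 2 * \<beta>2)) * of_nat ((\<beta>1 + \<beta>2) choose \<beta>1)
          * fact \<alpha> * (fact (\<beta>1 + 2 * \<beta>2) / 2 ^ \<beta>2) * (- 1) ^ (\<alpha> + \<beta>1))
        (x1 ^ (j + n + \<alpha> + \<beta>2) * x2 ^ (k + p - \<alpha> + \<beta>1)
          * x3 ^ (l + q - \<beta>1 - \<beta>2) * x4 ^ (m + r - \<alpha> - \<beta>1 - 2 * \<beta>2)))"
  (is "?lhs = (\<Sum>\<alpha> = 0..min m p. \<Sum>(\<beta>1, \<beta>2) \<in> ?B \<alpha>. ?term \<alpha> \<beta>1 \<beta>2)")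
proof -
  define summand where "summand \<alpha> \<beta>1 \<beta>2 = x1 ^ (j + n) * x2 ^ k * x3 ^ l *
     (if \<alpha> + (\<beta>1 + 2 * \<beta>2) \<le> m then
       scl (of_nat (p choose \<alpha>) * (- 1) ^ \<alpha> *
         (of_nat (q choose (\<beta>1 + \<beta>2)) * of_nat ((\<beta>1 + \<beta>2) choose \<beta>1) * (- 1) ^ \<beta>1 / 2 ^ \<beta>2)
         * (fact m / fact (m - (\<alpha> + (\<beta>1 + 2 * \<beta>2)))))
        (x1 ^ (\<alpha> + \<beta>2) * x2 ^ (p - \<alpha> + \<beta>1) * x3 ^ (q - (\<beta>1 + \<beta>2)) * x4 ^ (m - (\<alpha> + (\<beta>1 + 2 * \<beta>2)))) else 0)
     * x4 ^ r" for \<alpha> \<beta>1 \<beta>2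
  have summand_eq_0: "summand \<alpha> \<beta>1 \<beta>2 = 0" if "m < \<alpha> + (\<beta>1 + 2 * \<beta>2)" for \<alpha> \<beta>1 \<beta>2
    using that by (simp add: summand_def)
  have summand_eq: "summand \<alpha> \<beta>1 \<beta>2 = ?term \<alpha> \<beta>1 \<beta>2"
    if "\<alpha> \<le> m" "\<alpha> \<le> p" "\<beta>1 + \<beta>2 \<le> q" "\<beta>1 + 2 * \<beta>2 \<le> m - \<alpha>" for \<alpha> \<beta>1 \<beta>2
  proof -
    \<comment> \<open>Each truncated subtraction is regrouped so that the power splits into the power from the
      outer factor and the one from the expansion.\<close>
    have exponents: "k + p - \<alpha> + \<beta>1 = k + (p - \<alpha> + \<beta>1)" "l + q - \<beta>1 - \<beta>2 = l + (q - (\<beta>1 + \<beta>2))"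
      "m + r - \<alpha> - \<beta>1 - 2 * \<beta>2 = m - (\<alpha> + (\<beta>1 + 2 * \<beta>2)) + r" "\<alpha> + (\<beta>1 + 2 * \<beta>2) \<le> m"
      using that by auto
    have word: "x1 ^ (j + n) * x2 ^ k * x3 ^ l *
        (x1 ^ (\<alpha> + \<beta>2) * x2 ^ (p - \<alpha> + \<beta>1) * x3 ^ (q - (\<beta>1 + \<beta>2)) * x4 ^ (m - (\<alpha> + (\<beta>1 + 2 * \<beta>2)))) * x4 ^ r =
      x1 ^ (j + n + \<alpha> + \<beta>2) * x2 ^ (k + p - \<alpha> + \<beta>1) * x3 ^ (l + q - \<beta>1 - \<beta>2)
        * x4 ^ (m + r - \<alpha> - \<beta>1 - 2 * \<beta>2)"
      unfolding exponents by (simp only: power_add mult.assoc normal_order)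
    show ?thesis
      unfolding summand_def falling_factorial_split[OF that(1,4)]
      by (simp only: exponents(4) if_True scale_mult_left scale_mult_right word) (simp add: power_add mult_ac)
  qed
  have "?lhs = x1 ^ (j + n) * x2 ^ k * x3 ^ l * (x4 ^ m * (x2 ^ p * x3 ^ q)) * x4 ^ r"
    by (simp only: power_add mult.assoc normal_order)
  also have "\<dots> = (\<Sum>\<alpha>\<le>p. \<Sum>(\<beta>1, \<beta>2) \<in> {(\<beta>1, \<beta>2). \<beta>1 + \<beta>2 \<le> q}. summand \<alpha> \<beta>1 \<beta>2)"
    unfolding x4_power_times summand_def case_prod_unfold sum_distrib_left sum_distrib_right ..
  \<comment> \<open>The terms with too high a power of \<open>t\<close> vanish, which cuts the ranges down to those of the
    formula.\<close>
  also have "\<dots> = (\<Sum>\<alpha> = 0..min m p. \<Sum>(\<beta>1, \<beta>2) \<in> {(\<beta>1, \<beta>2). \<beta>1 + \<beta>2 \<le> q}. summand \<alpha> \<beta>1 \<beta>2)"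
    by (rule sum.mono_neutral_right) (auto intro!: sum.neutral summand_eq_0)
  also have "\<dots> = (\<Sum>\<alpha> = 0..min m p. \<Sum>(\<beta>1, \<beta>2) \<in> ?B \<alpha>. ?term \<alpha> \<beta>1 \<beta>2)"
  proof (rule sum.cong[OF refl])
    fix \<alpha> assume \<alpha>: "\<alpha> \<in> {0..min m p}"
    show "(\<Sum>(\<beta>1, \<beta>2) \<in> {(\<beta>1, \<beta>2). \<beta>1 + \<beta>2 \<le> q}. summand \<alpha> \<beta>1 \<beta>2) = (\<Sum>(\<beta>1, \<beta>2) \<in> ?B \<alpha>. ?term \<alpha> \<beta>1 \<beta>2)"
    proof (rule sum.mono_neutral_cong_right)
      show "finite {(a, b). a + b \<le> q}" by (rule finite_pairs)
      show "\<forall>b\<in>{(a, b). a + b \<le> q} - ?B \<alpha>. (case b of (\<beta>1, \<beta>2) \<Rightarrow> summand \<alpha> \<beta>1 \<beta>2) = 0"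
        using \<alpha> by (auto intro!: summand_eq_0)
      show "(case b of (\<beta>1, \<beta>2) \<Rightarrow> summand \<alpha> \<beta>1 \<beta>2) = (case b of (\<beta>1, \<beta>2) \<Rightarrow> ?term \<alpha> \<beta>1 \<beta>2)"
        if "b \<in> ?B \<alpha>" for b
        using \<alpha> that by (cases b) (simp add: summand_eq)
    qed auto
  qed
  finally show ?thesis .
qed

end

section \<open>The universal enveloping algebra\<close>

lemma n41_algebra_U: "n41_algebra ((*\<^sub>U) :: 'f::field_char_0 \<Rightarrow> _) (X 1) (X 2) (X 3) (X 4)"
proof -
  interpret \<iota>: Vector_Spaces.linear "(*s)" "(*\<^sub>U)" "\<iota> :: 'f ^ 4 \<Rightarrow> 'f U_n41"
    by (rule linear_\<iota>)
  interpret U: assoc_algebra "(*\<^sub>U) :: 'f \<Rightarrow> 'f U_n41 \<Rightarrow> 'f U_n41"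
    by (rule assoc_algebra_U_n41)
  have swap: "X i * X j = (X j * X i :: 'f U_n41)"
    if "n41_bracket (axis j 1) (axis i 1) = (0 :: 'f ^ 4)" for i j
    using \<iota>_bracket[of "axis j 1 :: 'f ^ 4" "axis i 1"] that by (simp add: \<iota>.zero)
  show ?thesis
  proof
    show "X 4 * X 2 = (X 2 * X 4 - X 1 :: 'f U_n41)" "X 4 * X 3 = (X 3 * X 4 - X 2 :: 'f U_n41)"
      using \<iota>_bracket[of "axis 4 1 :: 'f ^ 4" "axis 2 1"] \<iota>_bracket[of "axis 4 1 :: 'f ^ 4" "axis 3 1"]
      by (simp_all add: n41_bracket_basis(1,2) \<iota>.neg algebra_simps)
  qed (rule swap, simp add: n41_bracket_basis(3,4))+
qed

theorem theorem4p2: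
  fixes j k l m n p q r :: nat
  shows "((X 1 ^ j * X 2 ^ k * X 3 ^ l * X 4 ^ m) * (X 1 ^ n * X 2 ^ p * X 3 ^ q * X 4 ^ r) =
      (\<Sum>\<alpha> = 0..min m p. \<Sum>(\<beta>1, \<beta>2) \<in> {(\<beta>1, \<beta>2). \<beta>1 + \<beta>2 \<le> q \<and> \<beta>1 + 2 * \<beta>2 \<le> m - \<alpha>}.
        (of_nat (m choose \<alpha>) * of_nat (p choose \<alpha>) * of_nat (q choose (\<beta>1 + \<beta>2))
          * of_nat ((m - \<alpha>) choose (\<beta>1 + 2 * \<beta>2)) * of_nat ((\<beta>1 + \<beta>2) choose \<beta>1)
          * fact \<alpha> * (fact (\<beta>1 + 2 * \<beta>2) / 2 ^ \<beta>2) * (- 1) ^ (\<alpha> + \<beta>1) :: real)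
        *\<^sub>U (X 1 ^ (j + n + \<alpha> + \<beta>2) * X 2 ^ (k + p - \<alpha> + \<beta>1)
          * X 3 ^ (l + q - \<beta>1 - \<beta>2) * X 4 ^ (m + r - \<alpha> - \<beta>1 - 2 * \<beta>2)))) \<and>
    ((X 1 ^ j * X 2 ^ k * X 3 ^ l * X 4 ^ m) * (X 1 ^ n * X 2 ^ p * X 3 ^ q * X 4 ^ r) =
      (\<Sum>\<alpha> = 0..min m p. \<Sum>(\<beta>1, \<beta>2) \<in> {(\<beta>1, \<beta>2). \<beta>1 + \<beta>2 \<le> q \<and> \<beta>1 + 2 * \<beta>2 \<le> m - \<alpha>}.
        (of_nat (m choose \<alpha>) * of_nat (p choose \<alpha>) * of_nat (q choose (\<beta>1 + \<beta>2))
          * of_nat ((m - \<alpha>) choose (\<beta>1 + 2 * \<beta>2)) * of_nat ((\<beta>1 + \<beta>2) choose \<beta>1)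
          * fact \<alpha> * (fact (\<beta>1 + 2 * \<beta>2) / 2 ^ \<beta>2) * (- 1) ^ (\<alpha> + \<beta>1) :: complex)
        *\<^sub>U (X 1 ^ (j + n + \<alpha> + \<beta>2) * X 2 ^ (k + p - \<alpha> + \<beta>1)
          * X 3 ^ (l + q - \<beta>1 - \<beta>2) * X 4 ^ (m + r - \<alpha> - \<beta>1 - 2 * \<beta>2))))"
  using n41_algebra.ordered_monomial_product[OF n41_algebra_U, where 'f = real]
    n41_algebra.ordered_monomial_product[OF n41_algebra_U, where 'f = complex]
  by blast

end
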